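(* Let $H$ be a separable Hilbert space, $C,C'\in GL(H)$, and let $W=\{(W_i,v_i)\}_{i\in I}$ be a $CC'$-controlled fusion frame for $H$ with frame bounds $A,B$. Let $0\le\lambda_1,\lambda_2<1$ be real numbers, let $\beta=\{c_i\}_{i\in I}\in\ell^2(I)$ be a sequence of positive real numbers, and let $Z=\{(Z_i,v_i)\}_{i\in I}$ be a $(\lambda_1,\lambda_2,\beta,C,C')$-perturbation of $W$. Then $Z$ is a $CC'$-controlled fusion frame for $H$ with bounds $$\left(\frac{(1-\lambda_1)\sqrt{A}-\|\beta\|_2}{1+\lambda_2}\right)^2\quad\text{(lower)},\qquad \left(\frac{(1+\lambda_1)\sqrt{B}+\|\beta\|_2}{1-\lambda_2}\right)^2\quad\text{(upper)}.$$
   Context: $I$ is a countable index set. $GL(H)$ is the set of bounded linear operators on $H$ having a bounded inverse; $\pi_V$ is the orthogonal projection of $H$ onto a closed subspace $V$. An operator $P\in\mathcal{B}(H)$ is positive if it is self-adjoint and $\langle Pf,f\rangle\ge 0$ for all $f$; $P^{1/2}$ is its positive square root. For a family $\{g_i\}_{i\in I}$ in $H$, $\|\{g_i\}_{i\in I}\|_2=(\sum_{i\in I}\|g_i\|^2)^{1/2}$; $\|\beta\|_2=(\sum_{i\in I}c_i^2)^{1/2}$. Let $\{W_i\}_{i\in I}$ be closed subspaces of $H$ and $v_i>0$ real numbers. $\{(W_i,v_i)\}_{i\in I}$ is a $CC'$-controlled fusion frame for $H$ with (lower and upper) bounds $A,B$ if $0<A\le B<\infty$ and $A\|f\|^2\le\sum_{i\in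 I}v_i^2\langle\pi_{W_i}C'f,\pi_{W_i}Cf\rangle\le B\|f\|^2$ for all $f\in H$. Definition of perturbation: let $W=\{(W_i,v_i)\}_{i\in I}$ and $Z=\{(Z_i,v_i)\}_{i\in I}$ be $CC'$-controlled fusion frames for $H$, where for every $i\in I$ the operators $C^*\pi_{W_i}C'$, $C^*\pi_{Z_i}C'$ and $C^*\pi_{W_i}C'-C^*\pi_{Z_i}C'$ are positive. $Z$ is a $(\lambda_1,\lambda_2,\beta,C,C')$-perturbation of $W$ if for all $f\in H$ $$\big\|\{v_i(C^*\pi_{W_i}C'-C^*\pi_{Z_i}C')^{1/2}f\}_{i\in I}\big\|_2\le\lambda_1\big\|\{v_i(C^*\pi_{W_i}C')^{1/2}f\}_{i\in I}\big\|_2+\lambda_2\big\|\{v_i(C^*\pi_{Z_i}C')^{1/2}f\}_{i\in I}\big\|_2+\|\beta\|_2\|f\|.$$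
   Formalization: The lower bound is asserted only when ‖β‖₂ < (1−λ₁)√A, since without this it can fail (e.g. H=ℝ, W=Z, A=B=1, λ₁=λ₂=0, β=(10)); the frame property and the upper bound are proved without it. *)

theory Defs
  imports "HOL-Analysis.Analysis"
begin

section \<open>Scalars\<close>

text \<open>
  Real and complex Hilbert spaces are treated uniformly.  In a model of the following class every
  \<open>z\<close> is a root of the real polynomial \<open>X^2 - (z + kcnj z) X + |z|^2\<close>, so the only models are
  the reals with the identity and the complex numbers with complex conjugation.
\<close>

class real_or_complex = real_normed_field +
  fixes kcnj :: "'a \<Rightarrow> 'a"
  assumes kcnj_add: "kcnj (x + y) = kcnj x + kcnj y"
    and kcnj_mult: "kcnj (x * y) = kcnj x * kcnj y"
    and mult_kcnj: "x * kcnj x = ((norm x)\<^sup>2) *\<^sub>R 1"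

instantiation real :: real_or_complex
begin
definition kcnj_real :: "real \<Rightarrow> real" where "kcnj_real x = x"
instance by standard (auto simp: kcnj_real_def power2_eq_square)
end

instantiation complex :: real_or_complex
begin
definition kcnj_complex :: "complex \<Rightarrow> complex" where "kcnj_complex x = cnj x"
instance
  by standard
    (simp_all add: kcnj_complex_def scaleR_conv_of_real complex_norm_square [symmetric])
end


section \<open>Hilbert spaces and operators\<close>

text \<open>
  Completeness, the norm and the topology come from the class \<^class>\<open>banach\<close>; the inner product is
  linear in its first argument and induces the norm.
\<close>

locale hilbert_space = vector_space smul
  for smul :: "'k::real_or_complex \<Rightarrow> 'a::banach \<Rightarrow> 'a" +
  fixes ip :: "'a \<Rightarrow> 'a \<Rightarrow> 'k"
  assumes scale_of_real: "smul (of_real r) x = r *\<^sub>R x"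
    and ip_add_left: "ip (x + y) z = ip x z + ip y z"
    and ip_scale_left: "ip (smul a x) y = a * ip x y"
    and ip_commute: "ip y x = kcnj (ip x y)"
    and ip_self: "ip x x = of_real ((norm x)\<^sup>2)"

lemma hilbert_space_real:
  "hilbert_space (*\<^sub>R) (inner :: 'a::{real_inner,banach} \<Rightarrow> 'a \<Rightarrow> real)"
  by unfold_locales
    (auto simp: algebra_simps inner_add_left inner_commute kcnj_real_def dot_square_norm)

lemma hilbert_space_complex: "hilbert_space (*) (\<lambda>x y :: complex. x * cnj y)"
  by unfold_locales
    (simp_all add: algebra_simps scaleR_conv_of_real kcnj_complex_def complex_norm_square [symmetric])

definition bounded_op :: "('k::real_or_complex \<Rightarrow> 'a::banach \<Rightarrow> 'a) \<Rightarrow> ('a \<Rightarrow> 'a) \<Rightarrow> bool" where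
  "bounded_op smul T \<longleftrightarrow>
     Vector_Spaces.linear smul smul T \<and> (\<exists>K. \<forall>x. norm (T x) \<le> K * norm x)"

definition GL :: "('k::real_or_complex \<Rightarrow> 'a::banach \<Rightarrow> 'a) \<Rightarrow> ('a \<Rightarrow> 'a) set" where
  "GL smul = {T. bounded_op smul T \<and> (\<exists>S. bounded_op smul S \<and> S \<circ> T = id \<and> T \<circ> S = id)}"

definition closed_subspace :: "('k::real_or_complex \<Rightarrow> 'a::banach \<Rightarrow> 'a) \<Rightarrow> 'a set \<Rightarrow> bool" where
  "closed_subspace smul V \<longleftrightarrow> module.subspace smul V \<and> closed V"

definition orth_proj :: "('a::banach \<Rightarrow> 'a \<Rightarrow> 'k::real_or_complex) \<Rightarrow> 'a set \<Rightarrow> 'a \<Rightarrow> 'a" where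
  "orth_proj ip V x = (THE y. y \<in> V \<and> (\<forall>z\<in>V. ip (x - y) z = 0))"

definition hadjoint :: "('a::banach \<Rightarrow> 'a \<Rightarrow> 'k::real_or_complex) \<Rightarrow> ('a \<Rightarrow> 'a) \<Rightarrow> 'a \<Rightarrow> 'a" where
  "hadjoint ip T = (THE S. \<forall>x y. ip (T x) y = ip x (S y))"

definition positive_op ::
  "('k::real_or_complex \<Rightarrow> 'a::banach \<Rightarrow> 'a) \<Rightarrow> ('a \<Rightarrow> 'a \<Rightarrow> 'k) \<Rightarrow> ('a \<Rightarrow> 'a) \<Rightarrow> bool" where
  "positive_op smul ip P \<longleftrightarrow>
     bounded_op smul P \<and> hadjoint ip P = P \<and> (\<forall>f. \<exists>r\<ge>0. ip (P f) f = of_real r)"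

definition sqrt_op ::
  "('k::real_or_complex \<Rightarrow> 'a::banach \<Rightarrow> 'a) \<Rightarrow> ('a \<Rightarrow> 'a \<Rightarrow> 'k) \<Rightarrow> ('a \<Rightarrow> 'a) \<Rightarrow> 'a \<Rightarrow> 'a" where
  "sqrt_op smul ip P = (THE R. positive_op smul ip R \<and> R \<circ> R = P)"


section \<open>Controlled fusion frames and their perturbations\<close>

text \<open>
  The sum is a scalar; that it lies between real numbers means in particular that it converges
  (unconditionally) to a real number.
\<close>

definition controlled_fusion_frame ::
  "('k::real_or_complex \<Rightarrow> 'a::banach \<Rightarrow> 'a) \<Rightarrow> ('a \<Rightarrow> 'a \<Rightarrow> 'k) \<Rightarrow> ('a \<Rightarrow> 'a) \<Rightarrow> ('a \<Rightarrow> 'a)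
    \<Rightarrow> 'i set \<Rightarrow> ('i \<Rightarrow> 'a set) \<Rightarrow> ('i \<Rightarrow> real) \<Rightarrow> real \<Rightarrow> real \<Rightarrow> bool" where
  "controlled_fusion_frame smul ip C C' I W v A B \<longleftrightarrow>
     (\<forall>i\<in>I. closed_subspace smul (W i) \<and> v i > 0) \<and> 0 < A \<and> A \<le> B \<and>
     (\<forall>f. \<exists>s::real.
        ((\<lambda>i. of_real ((v i)\<^sup>2) * ip (orth_proj ip (W i) (C' f)) (orth_proj ip (W i) (C f)))
           has_sum of_real s) I \<and>
        A * (norm f)\<^sup>2 \<le> s \<and> s \<le> B * (norm f)\<^sup>2)"

definition ctrl_op ::
  "('a::banach \<Rightarrow> 'a \<Rightarrow> 'k::real_or_complex) \<Rightarrow> ('a \<Rightarrow> 'a) \<Rightarrow> ('a \<Rightarrow> 'a) \<Rightarrow> 'a set \<Rightarrow> 'a \<Rightarrow> 'a" where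
  "ctrl_op ip C C' V = hadjoint ip C \<circ> orth_proj ip V \<circ> C'"

definition l2_norm :: "'i set \<Rightarrow> ('i \<Rightarrow> 'b::real_normed_vector) \<Rightarrow> real" where
  "l2_norm I g = sqrt (\<Sum>\<^sub>\<infinity>i\<in>I. (norm (g i))\<^sup>2)"

text \<open>
  In the inequality below all three families are square summable, by the two frame conditions and
  \<open>\<parallel>P\<^sup>1\<^sup>/\<^sup>2 f\<parallel>\<^sup>2 = \<langle>P f, f\<rangle>\<close>, so \<^const>\<open>infsum\<close> never takes its default value.
\<close>

definition controlled_perturbation ::
  "('k::real_or_complex \<Rightarrow> 'a::banach \<Rightarrow> 'a) \<Rightarrow> ('a \<Rightarrow> 'a \<Rightarrow> 'k) \<Rightarrow> 'i set
    \<Rightarrow> real \<Rightarrow> real \<Rightarrow> ('i \<Rightarrow> real) \<Rightarrow> ('a \<Rightarrow> 'a) \<Rightarrow> ('a \<Rightarrow> 'a)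
    \<Rightarrow> ('i \<Rightarrow> real) \<Rightarrow> ('i \<Rightarrow> 'a set) \<Rightarrow> ('i \<Rightarrow> 'a set) \<Rightarrow> bool" where
  "controlled_perturbation smul ip I lam1 lam2 \<beta> C C' v W Z \<longleftrightarrow>
     (\<exists>A B. controlled_fusion_frame smul ip C C' I W v A B) \<and>
     (\<exists>A B. controlled_fusion_frame smul ip C C' I Z v A B) \<and>
     (\<forall>i\<in>I. positive_op smul ip (ctrl_op ip C C' (W i)) \<and>
             positive_op smul ip (ctrl_op ip C C' (Z i)) \<and>
             positive_op smul ip (\<lambda>f. ctrl_op ip C C' (W i) f - ctrl_op ip C C' (Z i) f)) \<and>
     (\<forall>f. l2_norm I (\<lambda>i. v i *\<^sub>R sqrt_op smul ip
                        (\<lambda>g. ctrl_op ip C C' (W i) g - ctrl_op ip C C' (Z i) g) f)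
          \<le> lam1 * l2_norm I (\<lambda>i. v i *\<^sub>R sqrt_op smul ip (ctrl_op ip C C' (W i)) f)
            + lam2 * l2_norm I (\<lambda>i. v i *\<^sub>R sqrt_op smul ip (ctrl_op ip C C' (Z i)) f)
            + l2_norm I \<beta> * norm f)"

end

theory Submission
  imports Defs
begin

text \<open>
  Since \<open>\<parallel>P\<^sup>1\<^sup>/\<^sup>2 f\<parallel>\<^sup>2 = \<langle>P f, f\<rangle>\<close>, the \<open>\<ell>\<^sup>2\<close>-norms of the families built from \<open>W\<close>, \<open>Z\<close> and their
  differences are numbers \<open>w\<close>, \<open>z\<close> and \<open>d\<close> with \<open>d\<^sup>2 = w\<^sup>2 - z\<^sup>2\<close>.  Positivity of the differences
  gives \<open>z \<le> w\<close>, so the upper bound \<open>B\<close> of \<open>W\<close>, which is below the claimed one, already works for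
  \<open>Z\<close>.  Moreover \<open>w - z \<le> d\<close>, and the perturbation inequality turns this into
  \<open>(1 - \<lambda>\<^sub>1) w - \<parallel>\<beta>\<parallel> \<parallel>f\<parallel> \<le> (1 + \<lambda>\<^sub>2) z\<close>.
  The square root of \<open>P = K (I - T)\<close> with \<open>\<parallel>T\<parallel> \<le> 1\<close> is given by the binomial series in \<open>T\<close>;
  it is unique because every operator commuting with \<open>P\<close> commutes with that series.
\<close>

section \<open>Scalars and inner products\<close>

lemma kcnj_0 [simp]: "kcnj (0::'a::real_or_complex) = 0"
  using kcnj_add[of "0::'a" 0] by simp

text \<open>The class axioms leave implicit that \<open>kcnj\<close> fixes the reals, is isometric
  and is an involution; all three follow by cancelling a nonzero factor in
  \<open>mult_kcnj\<close>.\<close>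

lemma kcnj_of_real [simp]: "kcnj (of_real r :: 'a::real_or_complex) = of_real r"
proof (cases "r = 0")
  case False
  have "of_real r * kcnj (of_real r :: 'a) = of_real r * of_real r"
    by (simp add: mult_kcnj power2_eq_square scaleR_conv_of_real flip: of_real_mult)
  then show ?thesis using False by simp
qed simp

lemma norm_kcnj [simp]: "norm (kcnj (z::'a::real_or_complex)) = norm z"
proof (cases "z = 0")
  case False
  have "norm (z * kcnj z) = (norm z)\<^sup>2" by (simp add: mult_kcnj)
  then show ?thesis using False by (simp add: norm_mult power2_eq_square)
qed simp

lemma kcnj_kcnj [simp]: "kcnj (kcnj (z::'a::real_or_complex)) = z"
proof (cases "z = 0")
  case False
  have "kcnj z * kcnj (kcnj z) = kcnj z * z"
    using mult_kcnj[of "kcnj z"] mult_kcnj[of z] by (simp add: mult.commute)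
  moreover have "kcnj z \<noteq> 0" using norm_kcnj[of z] False by (metis norm_eq_zero)
  ultimately show ?thesis by simp
qed simp

section \<open>Real part of the inner product and Cauchy-Schwarz\<close>

context hilbert_space
begin

text \<open>The real part of \<open>ip\<close>, which the class \<^class>\<open>real_or_complex\<close> does not name directly.\<close>

definition rip :: "'a \<Rightarrow> 'a \<Rightarrow> real" where
  "rip x y = ((norm (x + y))\<^sup>2 - (norm x)\<^sup>2 - (norm y)\<^sup>2) / 2"

lemma ip_add_right: "ip x (y + z) = ip x y + ip x z"
  by (metis ip_add_left ip_commute kcnj_add)

lemma ip_scale_right: "ip x (smul a y) = kcnj a * ip x y"
  by (metis ip_scale_left ip_commute kcnj_mult)

lemma of_real_rip: "of_real (2 * rip x y) = ip x y + ip y x"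
proof -
  have "of_real ((norm (x + y))\<^sup>2) = ip (x + y) (x + y)" by (simp only: ip_self)
  also have "\<dots> = ip x x + ip x y + ip y x + ip y y"
    by (simp add: ip_add_left ip_add_right)
  finally show ?thesis by (simp add: rip_def ip_self)
qed

lemma rip_eqI: "of_real (2 * r) = ip x y + ip y x \<Longrightarrow> rip x y = r"
  using of_real_rip[of x y] by (metis of_real_eq_iff mult_left_cancel zero_neq_numeral)

lemma rip_commute: "rip x y = rip y x"
  by (simp add: rip_def add.commute)

lemma rip_self: "rip x x = (norm x)\<^sup>2"
  by (rule rip_eqI) (simp add: ip_self)

lemma rip_add_left: "rip (x + y) z = rip x z + rip y z"
  by (rule rip_eqI) (simp add: distrib_left of_real_rip ip_add_left ip_add_right
      del: of_real_mult)

lemma rip_scaleR_left: "rip (r *\<^sub>R x) y = r * rip x y"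
proof (rule rip_eqI)
  have "of_real (2 * (r * rip x y)) = of_real r * (of_real (2 * rip x y) :: 'k)" by simp
  also have "\<dots> = ip (smul (of_real r) x) y + ip y (smul (of_real r) x)"
    by (simp only: of_real_rip ip_scale_left ip_scale_right kcnj_of_real distrib_left)
  finally show "of_real (2 * (r * rip x y)) = ip (r *\<^sub>R x) y + ip y (r *\<^sub>R x)"
    by (simp only: scale_of_real)
qed

text \<open>Since \<open>rip\<close> is defined from norms, the squared triangle inequality is the
  bound from above; \<open>- x\<close> gives the other sign.\<close>

lemma abs_rip_le: "\<bar>rip x y\<bar> \<le> norm x * norm y"
proof -
  have *: "rip u y \<le> norm u * norm y" for u
  proof -
    have "(norm (u + y))\<^sup>2 \<le> (norm u + norm y)\<^sup>2"
      by (intro power_mono norm_triangle_ineq norm_ge_zero)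
    then show ?thesis by (simp add: rip_def power2_sum)
  qed
  have "- rip x y \<le> norm x * norm y"
    using *[of "- x"] rip_scaleR_left[of "-1" x y] by simp
  with *[of x] show ?thesis by linarith
qed

sublocale rip: bounded_bilinear rip
proof
  show "rip x (y + z) = rip x y + rip x z" for x y z
    by (metis rip_commute rip_add_left)
  show "rip x (r *\<^sub>R y) = r *\<^sub>R rip x y" for x y r
    by (metis rip_commute rip_scaleR_left real_scaleR_def)
  show "\<exists>K. \<forall>a b. norm (rip a b) \<le> norm a * norm b * K"
    by (rule exI[of _ 1]) (simp add: abs_rip_le)
qed (simp_all add: rip_add_left rip_scaleR_left)

lemma norm_diff_sq: "(norm (x - y))\<^sup>2 = (norm x)\<^sup>2 - 2 * rip x y + (norm y)\<^sup>2"
  by (simp add: rip_self[symmetric] rip.diff_left rip.diff_right rip_commute)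

lemma norm_smul: "norm (smul a x) = norm a * norm x"
proof -
  have "(of_real ((norm (smul a x))\<^sup>2) :: 'k) = (a * kcnj a) * ip x x"
    by (simp only: ip_self[symmetric] ip_scale_left ip_scale_right mult.assoc mult.left_commute)
  also have "\<dots> = of_real ((norm a * norm x)\<^sup>2)"
    by (simp add: mult_kcnj ip_self power_mult_distrib scaleR_conv_of_real)
  finally have "(norm (smul a x))\<^sup>2 = (norm a * norm x)\<^sup>2" by (simp only: of_real_eq_iff)
  then show ?thesis by (simp add: power2_eq_iff_nonneg)
qed

lemma scaleR_smul: "r *\<^sub>R smul c x = smul c (r *\<^sub>R x)"
  by (simp add: scale_of_real[symmetric] mult.commute)

lemma bounded_linear_smul: "bounded_linear (smul c)"
  by (rule bounded_linear_intro[of _ "norm c"])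
    (simp_all add: scale_right_distrib scaleR_smul norm_smul mult.commute)

text \<open>A scalar is determined by the real parts of all its multiples, so identities for
  \<open>rip\<close> lift to \<open>ip\<close> without mention of an imaginary unit.\<close>

lemma ip_eqI:
  assumes "\<And>c. rip (smul c x) y = rip (smul c x') y'"
  shows "ip x y = ip x' y'"
proof -
  define D where "D = ip x y - ip x' y'"
  have *: "c * D + kcnj (c * D) = 0" for c
  proof -
    have "ip (smul c x) y + ip y (smul c x) = ip (smul c x') y' + ip y' (smul c x')"
      using assms[of c] by (metis of_real_rip)
    then have "c * ip x y + kcnj (c * ip x y) = c * ip x' y' + kcnj (c * ip x' y')"
      by (simp only: ip_commute[of y "smul c x"] ip_commute[of y' "smul c x'"] ip_scale_left)
    moreover have "kcnj (c * ip x y) = kcnj (c * D) + kcnj (c * ip x' y')"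
      by (simp add: kcnj_add[symmetric] D_def algebra_simps)
    ultimately show ?thesis by (simp add: D_def algebra_simps)
  qed
  \<comment> \<open>The test scalar \<open>kcnj D\<close> turns \<open>c * D\<close> into a real
    number.\<close>
  have "kcnj D * D = of_real ((norm D)\<^sup>2)"
    using mult_kcnj[of D] by (simp add: mult.commute scaleR_conv_of_real)
  then have "of_real (2 * (norm D)\<^sup>2) = (0::'k)"
    using *[of "kcnj D"] by (simp only: kcnj_of_real mult_2 of_real_add)
  then have "D = 0" by (metis of_real_eq_0_iff mult_eq_0_iff zero_neq_numeral
        power_eq_0_iff norm_eq_zero)
  then show ?thesis by (simp add: D_def)
qed

lemma ip_minus_left: "ip (- x) y = - ip x y"
  using ip_scale_left[of "-1" x y] scale_of_real[of "-1" x] by simp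

lemma ip_minus_right: "ip x (- y) = - ip x y"
  by (metis ip_minus_left ip_commute kcnj_of_real kcnj_mult mult_minus1 of_real_1 of_real_minus)

lemma ip_diff_left: "ip (x - y) z = ip x z - ip y z"
  using ip_add_left[of x "- y" z] by (simp add: ip_minus_left)

lemma ip_diff_right: "ip x (y - z) = ip x y - ip x z"
  using ip_add_right[of x y "- z"] by (simp add: ip_minus_right)

lemma ip_zero_left [simp]: "ip 0 y = 0"
  using ip_diff_left[of 0 0 y] by simp

lemma ip_zero_right [simp]: "ip x 0 = 0"
  using ip_diff_right[of x 0 0] by simp

text \<open>Multiplying \<open>x\<close> by \<open>ip y x\<close> makes the inner product with
  \<open>y\<close> real, namely \<open>(norm (ip x y))\<^sup>2\<close>; the bound for
  \<open>rip\<close> applies and one factor cancels.\<close>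

lemma norm_ip_le: "norm (ip x y) \<le> norm x * norm y"
proof -
  have "of_real (2 * (norm (ip x y))\<^sup>2) = ip (smul (ip y x) x) y + ip y (smul (ip y x) x)"
    using mult_kcnj[of "ip x y"]
    by (simp add: ip_scale_left ip_scale_right ip_commute[symmetric] scaleR_conv_of_real
        mult.commute)
  then have "(norm (ip x y))\<^sup>2 = rip (smul (ip y x) x) y" by (rule rip_eqI[symmetric])
  also have "\<dots> \<le> norm (ip y x) * norm x * norm y"
    using abs_rip_le[of "smul (ip y x) x" y] by (simp add: norm_smul)
  also have "norm (ip y x) = norm (ip x y)" by (metis ip_commute norm_kcnj)
  finally have "norm (ip x y) * norm (ip x y) \<le> norm (ip x y) * (norm x * norm y)"
    by (simp add: power2_eq_square mult.assoc)
  then show ?thesis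
    by (cases "ip x y = 0") (auto simp: mult_le_cancel_left)
qed

lemma eq_if_ip_eq:
  assumes "\<And>x. ip x y = ip x z"
  shows "y = z"
proof -
  have "ip (y - z) (y - z) = 0" using assms by (simp add: ip_diff_right)
  then show ?thesis by (simp add: ip_self)
qed

section \<open>Bounded operators\<close>

lemma bounded_op_iff: "bounded_op smul T \<longleftrightarrow>
  (\<forall>x y. T (x + y) = T x + T y) \<and> (\<forall>c x. T (smul c x) = smul c (T x)) \<and>
  (\<exists>K. \<forall>x. norm (T x) \<le> K * norm x)"
  by (simp add: bounded_op_def Vector_Spaces.linear_iff vector_space_axioms)

lemma bounded_op_bounded_linear:
  assumes "bounded_op smul T"
  shows "bounded_linear T"
proof -
  obtain K where "\<And>x. norm (T x) \<le> K * norm x" using assms by (auto simp: bounded_op_iff)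
  then show ?thesis using assms
    by (intro bounded_linear_intro[of _ K])
      (simp_all add: bounded_op_iff scale_of_real[symmetric] mult.commute)
qed

lemma bounded_opI:
  assumes "bounded_linear T" and "\<And>c x. T (smul c x) = smul c (T x)"
  shows "bounded_op smul T"
proof -
  interpret T: bounded_linear T by fact
  show ?thesis using T.bounded assms(2) by (auto simp: bounded_op_iff T.add mult.commute)
qed

section \<open>Orthogonal projections and adjoints\<close>

text \<open>The point of \<open>V\<close> nearest to \<open>x\<close>: a minimizing sequence
  converges by the parallelogram law, and minimality makes the residual orthogonal to
  \<open>V\<close>.\<close>

lemma orth_proj_ex:
  assumes "closed_subspace smul V"
  shows "\<exists>y\<in>V. \<forall>z\<in>V. ip (x - y) z = 0"
proof -
  have V: "subspace V" "closed V" using assms by (auto simp: closed_subspace_def)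
  have VR: "r *\<^sub>R y \<in> V" if "y \<in> V" for r y
    using subspace_scale[OF V(1) that, of "of_real r"] by (simp add: scale_of_real)
  have ne: "V \<noteq> {}" using subspace_0[OF V(1)] by auto
  define d where "d = infdist x V"
  have d0: "d \<ge> 0" by (simp add: d_def infdist_nonneg)
  have dle: "d \<le> norm (x - y)" if "y \<in> V" for y
    using infdist_le[OF that, of x] by (simp add: d_def dist_norm)
  have "\<exists>y\<in>V. norm (x - y) < d + 1 / real (Suc n)" for n
  proof (rule ccontr)
    assume "\<not> ?thesis"
    then have "d + 1 / real (Suc n) \<le> (INF y\<in>V. dist x y)"
      using ne by (intro cINF_greatest) (auto simp: dist_norm not_less)
    then show False using ne by (simp add: d_def infdist_notempty)
  qed
  then obtain y where yV: "\<And>n. y n \<in> V" and yd: "\<And>n. norm (x - y n) < d + 1 / real (Suc n)"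
    by metis
  \<comment> \<open>Parallelogram law for \<open>x - y m\<close> and \<open>x - y n\<close>: the
    midpoint of \<open>y m\<close> and \<open>y n\<close> lies in \<open>V\<close>, so half their
    sum has norm at least \<open>d\<close>.\<close>
  have par: "(norm (y m - y n))\<^sup>2 \<le> 2 * (norm (x - y m))\<^sup>2 + 2 * (norm (x - y n))\<^sup>2 - 4 * d\<^sup>2"
    for m n
  proof -
    define a b where "a = x - y m" and "b = x - y n"
    have "d \<le> norm (x - (1/2) *\<^sub>R (y m + y n))"
      by (intro dle VR subspace_add[OF V(1)] yV)
    also have "x - (1/2) *\<^sub>R (y m + y n) = (1/2) *\<^sub>R (a + b)"
      by (simp add: a_def b_def algebra_simps flip: scaleR_add_left)
    finally have "2 * d \<le> norm (a + b)" by simp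
    then have "(2 * d)\<^sup>2 \<le> (norm (a + b))\<^sup>2" using d0 by (intro power_mono) auto
    also have "\<dots> = 2 * (norm a)\<^sup>2 + 2 * (norm b)\<^sup>2 - (norm (b - a))\<^sup>2"
      by (simp add: rip_self[symmetric] rip.diff_left rip.diff_right rip.add_left rip.add_right
          rip_commute[of b a])
    also have "b - a = y m - y n" by (simp add: a_def b_def)
    finally show ?thesis by (simp add: a_def b_def power_mult_distrib)
  qed
  have lim: "(\<lambda>n. norm (x - y n)) \<longlonglongrightarrow> d"
  proof (rule tendsto_sandwich[of "\<lambda>_. d" _ _ "\<lambda>n. d + 1 / real (Suc n)"])
    show "(\<lambda>n. d + 1 / real (Suc n)) \<longlonglongrightarrow> d"
      using tendsto_add[OF tendsto_const LIMSEQ_inverse_real_of_nat, of d]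
      by (simp add: inverse_eq_divide)
  qed (use yd in \<open>auto intro!: always_eventually dle yV simp del: of_nat_Suc intro: less_imp_le\<close>)
  have "Cauchy y"
  proof (rule metric_CauchyI)
    fix e :: real assume e: "e > 0"
    have lim2: "(\<lambda>n. 2 * (norm (x - y n))\<^sup>2) \<longlonglongrightarrow> 2 * d\<^sup>2" by (intro tendsto_intros lim)
    \<comment> \<open>Two such terms together exceed \<open>4 * d\<^sup>2\<close> by less than
      \<open>e\<^sup>2\<close>.\<close>
    have "eventually (\<lambda>n. 2 * (norm (x - y n))\<^sup>2 < 2 * d\<^sup>2 + e\<^sup>2 / 2) sequentially"
      using e by (intro order_tendstoD(2)[OF lim2]) simp
    then obtain N where N: "\<And>n. n \<ge> N \<Longrightarrow> 2 * (norm (x - y n))\<^sup>2 < 2 * d\<^sup>2 + e\<^sup>2 / 2"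
      by (auto simp: eventually_sequentially)
    have "dist (y m) (y n) < e" if "m \<ge> N" "n \<ge> N" for m n
    proof -
      have "(norm (y m - y n))\<^sup>2 < e\<^sup>2" using par[of m n] N[OF that(1)] N[OF that(2)] by argo
      then show ?thesis using e by (simp add: dist_norm power2_less_imp_less)
    qed
    then show "\<exists>M. \<forall>m\<ge>M. \<forall>n\<ge>M. dist (y m) (y n) < e" by blast
  qed
  then obtain p where p: "y \<longlonglongrightarrow> p" using convergent_eq_Cauchy by blast
  have pV: "p \<in> V" using V(2) yV p by (rule closed_sequentially)
  have "(\<lambda>n. norm (x - y n)) \<longlonglongrightarrow> norm (x - p)" by (intro tendsto_intros p)
  then have pd: "norm (x - p) = d" using lim LIMSEQ_unique by blast
  have "ip (x - p) z = 0" if z: "z \<in> V" for z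
  proof -
    have "rip (x - p) w = 0" if w: "w \<in> V" for w
    proof (cases "w = 0")
      case False
      \<comment> \<open>This \<open>t\<close> minimizes the distance from \<open>x - p\<close> to
        the real multiples of \<open>w\<close>; it would beat \<open>d\<close> unless
        \<open>rip (x - p) w = 0\<close>.\<close>
      define t where "t = rip (x - p) w / (norm w)\<^sup>2"
      have "d \<le> norm (x - (p + t *\<^sub>R w))" by (intro dle subspace_add[OF V(1)] pV VR w)
      then have "d\<^sup>2 \<le> (norm (x - (p + t *\<^sub>R w)))\<^sup>2" using d0 by (intro power_mono)
      also have "x - (p + t *\<^sub>R w) = (x - p) - t *\<^sub>R w" by simp
      also have "(norm \<dots>)\<^sup>2 = d\<^sup>2 - 2 * t * rip (x - p) w + t\<^sup>2 * (norm w)\<^sup>2"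
        by (simp only: norm_diff_sq pd rip.scaleR_right real_scaleR_def norm_scaleR
            power_mult_distrib power2_abs mult.assoc)
      also have "\<dots> = d\<^sup>2 - (rip (x - p) w)\<^sup>2 / (norm w)\<^sup>2"
        using False by (simp add: t_def power2_eq_square field_simps)
      finally have "(rip (x - p) w)\<^sup>2 / (norm w)\<^sup>2 \<le> 0" by simp
      then have "(rip (x - p) w)\<^sup>2 \<le> 0" using False by (simp add: divide_le_0_iff)
      then show ?thesis by simp
    qed (simp add: rip.zero_right)
    \<comment> \<open>Since \<open>V\<close> contains every \<open>smul c z\<close>, the vanishing
      of \<open>rip\<close> on \<open>V\<close> gives that of \<open>ip\<close>.\<close>
    then have "ip z (x - p) = ip 0 0"
      using subspace_scale[OF V(1) z] by (intro ip_eqI) (metis rip_commute rip.zero_right)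
    then show ?thesis by (metis ip_commute ip_zero_left kcnj_0)
  qed
  with pV show ?thesis by blast
qed

text \<open>The description in \<open>orth_proj\<close> is unique: the difference of two candidates
  lies in \<open>V\<close> and is orthogonal to itself.\<close>

lemma orth_proj:
  assumes V: "closed_subspace smul V"
  shows orth_proj_in: "orth_proj ip V x \<in> V"
    and ip_orth_proj: "z \<in> V \<Longrightarrow> ip (x - orth_proj ip V x) z = 0"
proof -
  have "\<exists>!y. y \<in> V \<and> (\<forall>z\<in>V. ip (x - y) z = 0)"
  proof (rule ex_ex1I)
    show "\<exists>y. y \<in> V \<and> (\<forall>z\<in>V. ip (x - y) z = 0)" using orth_proj_ex[OF V] by blast
  next
    fix y y' assume y: "y \<in> V \<and> (\<forall>z\<in>V. ip (x - y) z = 0)"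
      and y': "y' \<in> V \<and> (\<forall>z\<in>V. ip (x - y') z = 0)"
    have "y - y' \<in> V" using V y y' by (auto simp: closed_subspace_def subspace_diff)
    then have "ip (x - y') (y - y') - ip (x - y) (y - y') = 0" using y y' by simp
    then have "ip (y - y') (y - y') = 0" by (simp add: ip_diff_left)
    then show "y = y'" by (simp add: ip_self)
  qed
  from theI'[OF this] show "orth_proj ip V x \<in> V" "z \<in> V \<Longrightarrow> ip (x - orth_proj ip V x) z = 0"
    unfolding orth_proj_def by auto
qed

text \<open>The Riesz argument: the representing vector spans the orthogonal complement of the kernel of
  \<open>x \<mapsto> ip (T x) y\<close>.\<close>

lemma adjoint_ex:
  assumes T: "bounded_op smul T"
  shows "\<exists>s. \<forall>x. ip (T x) y = ip x s"
proof (cases "\<forall>x. ip (T x) y = 0")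
  case True
  then show ?thesis by (intro exI[of _ 0]) simp
next
  case False
  then obtain u where u: "ip (T u) y \<noteq> 0" by blast
  interpret T: bounded_linear T by (rule bounded_op_bounded_linear[OF T])
  have Ts: "T (smul c x) = smul c (T x)" for c x using T by (simp add: bounded_op_iff)
  let ?V = "{x. ip (T x) y = 0}"
  have "bounded_linear (\<lambda>z. ip z y)"
    by (rule bounded_linear_intro[of _ "norm y"])
      (simp_all add: ip_add_left norm_ip_le scale_of_real[symmetric] ip_scale_left
        scaleR_conv_of_real)
  then have "continuous_on UNIV (\<lambda>x. ip (T x) y)"
    by (intro linear_continuous_on bounded_linear_compose[OF _ T.bounded_linear_axioms])
  then have "closed ?V"
    using closed_vimage[of "{0}" "\<lambda>x. ip (T x) y"] by (simp add: vimage_def)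
  then have V: "closed_subspace smul ?V"
    by (auto simp: closed_subspace_def subspace_def T.zero T.add Ts ip_add_left ip_scale_left)
  define w where "w = u - orth_proj ip ?V u"
  have w: "ip x w = 0" if "ip (T x) y = 0" for x
    using ip_orth_proj[OF V, of x u] that by (metis w_def ip_commute kcnj_0 mem_Collect_eq)
  have "ip (T (orth_proj ip ?V u)) y = 0" using orth_proj_in[OF V] by blast
  then have Tw: "ip (T w) y = ip (T u) y" by (simp add: w_def T.diff ip_diff_left)
  then have w0: "w \<noteq> 0" using u by (auto simp: T.zero)
  define a where "a = ip (T w) y"
  have "ip (T x) y = ip x (smul (kcnj (a / of_real ((norm w)\<^sup>2))) w)" for x
  proof -
    \<comment> \<open>This combination lies in the kernel \<open>?V\<close>, to which
      \<open>w\<close> is orthogonal.\<close>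
    have "ip (smul a x - smul (ip (T x) y) w) w = 0"
      by (rule w) (simp add: T.diff Ts ip_diff_left ip_scale_left a_def)
    then have "a * ip x w = ip (T x) y * of_real ((norm w)\<^sup>2)"
      by (simp add: ip_diff_left ip_scale_left ip_self)
    then show ?thesis using w0 by (simp add: ip_scale_right field_simps)
  qed
  then show ?thesis by blast
qed

lemma ip_hadjoint:
  assumes "bounded_op smul T"
  shows "ip (T x) y = ip x (hadjoint ip T y)"
proof -
  obtain S where S: "\<And>x y. ip (T x) y = ip x (S y)" using adjoint_ex[OF assms] by metis
  have "\<exists>!S. \<forall>x y. ip (T x) y = ip x (S y)"
  proof (rule ex_ex1I)
    fix S S' assume "\<forall>x y. ip (T x) y = ip x (S y)" "\<forall>x y. ip (T x) y = ip x (S' y)"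
    then show "S = S'" by (intro ext eq_if_ip_eq) metis
  qed (use S in blast)
  from theI'[OF this] show ?thesis unfolding hadjoint_def by blast
qed

section \<open>Self-adjointness, controlled operators and positivity\<close>

lemma hadjoint_eq_self_iff:
  assumes "bounded_op smul T"
  shows "hadjoint ip T = T \<longleftrightarrow> (\<forall>x y. ip (T x) y = ip x (T y))"
proof
  assume "\<forall>x y. ip (T x) y = ip x (T y)"
  then show "hadjoint ip T = T" 
    by (intro ext eq_if_ip_eq) (simp add: ip_hadjoint[OF assms, symmetric])
qed (metis ip_hadjoint[OF assms])

text \<open>The adjoint moves \<open>C\<close> to the other side, and the part of \<open>C f\<close>
  orthogonal to \<open>V\<close> contributes nothing. This links the frame summands to the operators
  of the perturbation inequality.\<close>

lemma ip_ctrl_op: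
  assumes C: "bounded_op smul C" and V: "closed_subspace smul V"
  shows "ip (ctrl_op ip C C' V f) f = ip (orth_proj ip V (C' f)) (orth_proj ip V (C f))"
proof -
  let ?p = "orth_proj ip V (C' f)"
  have "ip (ctrl_op ip C C' V f) f = ip ?p (C f)"
    using ip_hadjoint[OF C, of f ?p] by (metis ctrl_op_def comp_apply ip_commute)
  also have "ip (C f - orth_proj ip V (C f)) ?p = 0"
    by (intro ip_orth_proj orth_proj_in V)
  then have "ip ?p (C f - orth_proj ip V (C f)) = 0" by (metis ip_commute kcnj_0)
  then have "ip ?p (C f) = ip ?p (orth_proj ip V (C f))" by (simp add: ip_diff_right)
  finally show ?thesis .
qed

text \<open>Reduces positivity to the real form \<open>rip\<close>. Symmetry lifts back to
  \<open>ip\<close> by \<open>ip_eqI\<close>, because \<open>P\<close> commutes with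
  \<open>smul\<close>.\<close>

lemma positive_op_iff: "positive_op smul ip P \<longleftrightarrow>
  bounded_op smul P \<and> (\<forall>x y. rip (P x) y = rip x (P y)) \<and> (\<forall>x. 0 \<le> rip (P x) x)"
  (is "_ \<longleftrightarrow> ?R")
proof
  assume P: "positive_op smul ip P"
  then have b: "bounded_op smul P" by (simp add: positive_op_def)
  have s: "ip (P x) y = ip x (P y)" for x y
    using P b hadjoint_eq_self_iff[OF b] by (simp add: positive_op_def)
  have "rip (P x) y = rip x (P y)" for x y
    by (rule rip_eqI) (simp only: of_real_rip s)
  moreover have "0 \<le> rip (P x) x" for x
  proof -
    obtain r where "r \<ge> 0" "ip (P x) x = of_real r" using P by (auto simp: positive_op_def)
    then have "rip (P x) x = r"
      by (intro rip_eqI) (simp add: s[symmetric])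
    then show ?thesis using \<open>r \<ge> 0\<close> by simp
  qed
  ultimately show ?R using b by blast
next
  assume R: ?R
  then have b: "bounded_op smul P" by blast
  have s: "ip (P x) y = ip x (P y)" for x y
    using R by (intro ip_eqI) (metis bounded_op_iff)
  have "\<exists>r\<ge>0. ip (P x) x = of_real r" for x
  proof (intro exI conjI)
    show "0 \<le> rip (P x) x" using R by blast
    have "2 * ip (P x) x = 2 * of_real (rip (P x) x)"
      using of_real_rip[of "P x" x] s[of x x] by simp
    then show "ip (P x) x = of_real (rip (P x) x)" by simp
  qed
  then show "positive_op smul ip P"
    using b s by (simp add: positive_op_def hadjoint_eq_self_iff[OF b])
qed

lemma ip_positive_op:
  assumes "positive_op smul ip P"
  shows "ip (P x) x = of_real (rip (P x) x)"
proof -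
  obtain r where r: "ip (P x) x = of_real r" using assms by (auto simp: positive_op_def)
  then have "rip (P x) x = r"
    using ip_commute[of x "P x"] by (intro rip_eqI) simp
  with r show ?thesis by simp
qed

end

section \<open>Square roots of positive operators\<close>

text \<open>The Taylor coefficients of \<open>1 - sqrt (1 - t)\<close>, shifted by one; the recursion is
  \<open>y = (t + y\<^sup>2) / 2\<close> read coefficientwise.\<close>

fun sqrt_coeff :: "nat \<Rightarrow> real" where
  "sqrt_coeff 0 = 1 / 2"
| "sqrt_coeff (Suc n) = (\<Sum>i\<le>n. sqrt_coeff i * sqrt_coeff (n - i)) / 2"

lemma sqrt_coeff_nonneg: "0 \<le> sqrt_coeff n"
proof (induction n rule: less_induct)
  case (less n)
  then show ?case by (cases n) (auto intro!: sum_nonneg)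
qed

text \<open>Induction: by the recursion the next partial sum is 1/2 plus half the products over a
  triangle, which is part of the square of the previous sum and so contributes at most 1/2.\<close>

lemma sum_sqrt_coeff_le: "(\<Sum>n<N. sqrt_coeff n) \<le> 1"
proof (induction N)
  case (Suc N)
  have "(\<Sum>n<N. \<Sum>i\<le>n. sqrt_coeff i * sqrt_coeff (n - i)) =
      (\<Sum>(i,j)\<in>{(i,j). i + j < N}. sqrt_coeff i * sqrt_coeff j)"
    by (simp add: sum.triangle_reindex)
  also have "\<dots> \<le> (\<Sum>(i,j)\<in>{..<N} \<times> {..<N}. sqrt_coeff i * sqrt_coeff j)"
    by (intro sum_mono2) (auto simp: sqrt_coeff_nonneg)
  also have "\<dots> = (\<Sum>n<N. sqrt_coeff n)\<^sup>2"
    by (simp add: power2_eq_square sum_product sum.cartesian_product)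
  also have "\<dots> \<le> 1"
    using Suc by (intro power_le_one) (auto intro: sum_nonneg sqrt_coeff_nonneg)
  finally show ?case
    by (simp add: sum.lessThan_Suc_shift sum_divide_distrib[symmetric] del: sum.lessThan_Suc)
qed simp

lemma summable_on_sqrt_coeff: "sqrt_coeff summable_on UNIV"
  by (intro summable_nonneg_imp_summable_on sqrt_coeff_nonneg
      summableI_nonneg_bounded[OF _ sum_sqrt_coeff_le])

lemma infsum_sqrt_coeff_le: "(\<Sum>\<^sub>\<infinity>n. sqrt_coeff n) \<le> 1"
proof -
  have "sqrt_coeff sums (\<Sum>\<^sub>\<infinity>n. sqrt_coeff n)"
    by (intro has_sum_imp_sums has_sum_infsum summable_on_sqrt_coeff)
  then show ?thesis
    by (intro LIMSEQ_le_const2[of "\<lambda>N. \<Sum>n<N. sqrt_coeff n"])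
      (auto simp: sums_def sum_sqrt_coeff_le)
qed

section \<open>The square root series at a contraction\<close>

context hilbert_space
begin

text \<open>The operator \<open>1 - sqrt (1 - T)\<close>; the power \<open>Suc n\<close> undoes the
  index shift of \<open>sqrt_coeff\<close>.\<close>

definition sqrt_series :: "('a \<Rightarrow> 'a) \<Rightarrow> 'a \<Rightarrow> 'a" where
  "sqrt_series T x = (\<Sum>\<^sub>\<infinity>n. sqrt_coeff n *\<^sub>R (T ^^ Suc n) x)"

context
  fixes T :: "'a \<Rightarrow> 'a"
  assumes T: "bounded_linear T" and T_le: "\<And>x. norm (T x) \<le> norm x"
begin

lemma bounded_linear_funpow: "bounded_linear (T ^^ n)"
  by (induction n) (simp_all add: bounded_linear_ident[folded id_def] bounded_linear_compose[OF T]
      comp_def id_def)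

lemma norm_funpow_le: "norm ((T ^^ n) x) \<le> norm x"
  by (induction n) (auto intro: order_trans[OF T_le])

lemma abs_summable_sqrt_series: "(\<lambda>n. norm (sqrt_coeff n *\<^sub>R (T ^^ Suc n) x)) summable_on UNIV"
proof (rule Infinite_Sum.abs_summable_on_comparison_test')
  show "(\<lambda>n. sqrt_coeff n * norm x) summable_on UNIV"
    by (intro summable_on_cmult_left summable_on_sqrt_coeff)
qed (simp add: sqrt_coeff_nonneg mult_left_mono norm_funpow_le del: funpow.simps)

lemma has_sum_sqrt_series:
  "((\<lambda>n. sqrt_coeff n *\<^sub>R (T ^^ Suc n) x) has_sum sqrt_series T x) UNIV"
  unfolding sqrt_series_def
  by (intro has_sum_infsum abs_summable_summable[OF abs_summable_sqrt_series])

lemma norm_sqrt_series_le: "norm (sqrt_series T x) \<le> norm x"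
proof -
  have "norm (sqrt_series T x) \<le> (\<Sum>\<^sub>\<infinity>n. norm (sqrt_coeff n *\<^sub>R (T ^^ Suc n) x))"
    unfolding sqrt_series_def by (intro norm_infsum_bound abs_summable_sqrt_series)
  also have "\<dots> \<le> (\<Sum>\<^sub>\<infinity>n. sqrt_coeff n * norm x)"
    by (intro infsum_mono abs_summable_sqrt_series summable_on_cmult_left summable_on_sqrt_coeff)
      (simp add: sqrt_coeff_nonneg mult_left_mono norm_funpow_le del: funpow.simps)
  also have "\<dots> = (\<Sum>\<^sub>\<infinity>n. sqrt_coeff n) * norm x"
    by (intro infsum_cmult_left summable_on_sqrt_coeff)
  also have "\<dots> \<le> norm x"
    using mult_right_mono[OF infsum_sqrt_coeff_le norm_ge_zero[of x]] by simp
  finally show ?thesis .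
qed

text \<open>A bounded linear map passes through powers and sums. It is applied to scalar
  multiplications and, later, to a second square root.\<close>

lemma sqrt_series_commute:
  assumes S: "bounded_linear S" and ST: "\<And>x. S (T x) = T (S x)"
  shows "S (sqrt_series T x) = sqrt_series T (S x)"
proof -
  interpret S: bounded_linear S by fact
  have "S ((T ^^ n) x) = (T ^^ n) (S x)" for n
    by (induction n) (simp_all add: ST)
  then have "((\<lambda>n. sqrt_coeff n *\<^sub>R (T ^^ Suc n) (S x)) has_sum S (sqrt_series T x)) UNIV"
    using has_sum_bounded_linear[OF S has_sum_sqrt_series[of x]]
    by (simp add: S.scaleR ST del: sqrt_coeff.simps)
  then show ?thesis using has_sum_sqrt_series has_sum_unique by blast
qed

lemma bounded_linear_sqrt_series: "bounded_linear (sqrt_series T)"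
proof (rule bounded_linear_intro[of _ 1])
  interpret P: bounded_linear "T ^^ n" for n by (rule bounded_linear_funpow)
  show "sqrt_series T (x + y) = sqrt_series T x + sqrt_series T y" for x y
  proof -
    have "((\<lambda>n. sqrt_coeff n *\<^sub>R (T ^^ Suc n) (x + y)) has_sum
        sqrt_series T x + sqrt_series T y) UNIV"
      unfolding P.add scaleR_add_right by (intro has_sum_add has_sum_sqrt_series)
    then show ?thesis by (rule has_sum_unique[OF has_sum_sqrt_series])
  qed
  show "sqrt_series T (r *\<^sub>R x) = r *\<^sub>R sqrt_series T x" for r x
    by (rule sqrt_series_commute[symmetric])
      (simp_all add: bounded_linear_scaleR_right linear_cmul[OF bounded_linear.linear[OF T]])
qed (simp add: norm_sqrt_series_le)

text \<open>The operator form of \<open>y\<^sup>2 = 2 * y - t\<close>, the equation behind the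
  recursion of \<open>sqrt_coeff\<close>; absolute convergence permits the Cauchy product.\<close>

lemma sqrt_series_sqrt_series:
  "sqrt_series T (sqrt_series T x) = 2 *\<^sub>R sqrt_series T x - T x"
proof -
  define g where "g = (\<lambda>(i,j). (sqrt_coeff i * sqrt_coeff j) *\<^sub>R (T ^^ Suc (Suc (i + j))) x)"
  interpret P: bounded_linear "T ^^ n" for n by (rule bounded_linear_funpow)
  have "(\<lambda>p. norm (sqrt_coeff (fst p) * sqrt_coeff (snd p) * norm x)) summable_on UNIV \<times> UNIV"
    by (subst Infinite_Sum.abs_summable_on_Sigma_iff)
      (auto simp: abs_mult sqrt_coeff_nonneg infsum_cmult_right' infsum_cmult_left'
        intro!: summable_on_cmult_left summable_on_cmult_right summable_on_sqrt_coeff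
        simp flip: mult.assoc)
  then have "(\<lambda>p. norm (g p)) summable_on UNIV \<times> UNIV"
    by (rule Infinite_Sum.abs_summable_on_comparison_test)
      (auto simp: g_def abs_mult sqrt_coeff_nonneg mult_left_mono norm_funpow_le
        simp del: funpow.simps)
  then have g: "g summable_on UNIV \<times> UNIV" by (rule abs_summable_summable)
  let ?h = "\<lambda>(k, i). (i, k - i :: nat)"
  \<comment> \<open>Cauchy product: sum over the diagonals \<open>i + j = k\<close> instead of over the rows.\<close>
  have bij: "bij_betw ?h (SIGMA k:UNIV. {..k}) (UNIV \<times> UNIV)"
    by (rule bij_betwI[of _ _ _ "\<lambda>(i, j). (i + j, i)"]) auto
  have g': "(\<lambda>p. g (?h p)) summable_on (SIGMA k:UNIV. {..k})"
    using g summable_on_reindex_bij_betw[OF bij, of g] by simp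
  \<comment> \<open>All terms on a diagonal carry the same power of \<open>T\<close>, and the
    recursion sums their coefficients to twice the next one.\<close>
  have inner: "infsum (\<lambda>i. g (?h (k, i))) {..k} =
      2 *\<^sub>R (sqrt_coeff (Suc k) *\<^sub>R (T ^^ Suc (Suc k)) x)" for k
    by (simp add: g_def scaleR_left.sum[symmetric] del: funpow.simps)
  have "sqrt_series T (sqrt_series T x) =
      (\<Sum>\<^sub>\<infinity>i. sqrt_coeff i *\<^sub>R (T ^^ Suc i) (\<Sum>\<^sub>\<infinity>j. sqrt_coeff j *\<^sub>R (T ^^ Suc j) x))"
    by (simp only: sqrt_series_def)
  also have "\<dots> = (\<Sum>\<^sub>\<infinity>i. \<Sum>\<^sub>\<infinity>j. g (i, j))"
  proof (rule infsum_cong)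
    fix i
    have "((\<lambda>j. sqrt_coeff i *\<^sub>R (T ^^ Suc i) (sqrt_coeff j *\<^sub>R (T ^^ Suc j) x)) has_sum
        sqrt_coeff i *\<^sub>R (T ^^ Suc i) (sqrt_series T x)) UNIV"
      by (intro has_sum_bounded_linear[OF bounded_linear_scaleR_right]
          has_sum_bounded_linear[OF bounded_linear_funpow] has_sum_sqrt_series)
    also have "(\<lambda>j. sqrt_coeff i *\<^sub>R (T ^^ Suc i) (sqrt_coeff j *\<^sub>R (T ^^ Suc j) x)) =
        (\<lambda>j. g (i, j))"
      by (simp only: g_def prod.case P.scaleR scaleR_scaleR)
        (simp only: funpow_add[symmetric, THEN fun_cong, unfolded comp_def] add_Suc add_Suc_right)
    finally show "sqrt_coeff i *\<^sub>R (T ^^ Suc i) (\<Sum>\<^sub>\<infinity>j. sqrt_coeff j *\<^sub>R (T ^^ Suc j) x) =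
        (\<Sum>\<^sub>\<infinity>j. g (i, j))"
      by (simp only: sqrt_series_def[symmetric] infsumI)
  qed
  also have "\<dots> = infsum g (UNIV \<times> UNIV)" by (rule infsum_Sigma_banach[OF g])
  also have "\<dots> = infsum (\<lambda>p. g (?h p)) (SIGMA k:UNIV. {..k})"
    by (rule infsum_reindex_bij_betw[OF bij, symmetric])
  also have "\<dots> = (\<Sum>\<^sub>\<infinity>k. infsum (\<lambda>i. g (?h (k, i))) {..k})"
    by (rule infsum_Sigma_banach[OF g', symmetric])
  also have "\<dots> = (\<Sum>\<^sub>\<infinity>k. 2 *\<^sub>R (sqrt_coeff (Suc k) *\<^sub>R (T ^^ Suc (Suc k)) x))"
    by (simp only: inner)
  finally have eq: "sqrt_series T (sqrt_series T x) =
      (\<Sum>\<^sub>\<infinity>k. 2 *\<^sub>R (sqrt_coeff (Suc k) *\<^sub>R (T ^^ Suc (Suc k)) x))" .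
  have "(\<lambda>k. sqrt_coeff k *\<^sub>R (T ^^ Suc k) x) summable_on range Suc"
    by (rule summable_on_subset_banach[OF abs_summable_summable[OF abs_summable_sqrt_series]]) simp
  then have "(\<lambda>k. sqrt_coeff (Suc k) *\<^sub>R (T ^^ Suc (Suc k)) x) summable_on UNIV"
    by (subst (asm) summable_on_reindex) (simp_all only: comp_def inj_Suc)
  then have "((\<lambda>k. 2 *\<^sub>R (sqrt_coeff (Suc k) *\<^sub>R (T ^^ Suc (Suc k)) x)) has_sum
      sqrt_series T (sqrt_series T x)) UNIV"
    unfolding eq
    by (intro has_sum_infsum summable_on_bounded_linear[OF bounded_linear_scaleR_right])
  \<comment> \<open>The series found is that of \<open>2 *\<^sub>R sqrt_series T x\<close> without
    its term for \<open>n = 0\<close>, which is \<open>T x\<close> because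
    \<open>sqrt_coeff 0 = 1 / 2\<close>.\<close>
  from has_sum_imp_sums[OF this]
  have "(\<lambda>k. 2 *\<^sub>R (sqrt_coeff k *\<^sub>R (T ^^ Suc k) x)) sums
      (sqrt_series T (sqrt_series T x) + 2 *\<^sub>R (sqrt_coeff 0 *\<^sub>R (T ^^ Suc 0) x))"
    by (subst (asm) sums_Suc_iff) simp
  moreover have "(\<lambda>k. 2 *\<^sub>R (sqrt_coeff k *\<^sub>R (T ^^ Suc k) x)) sums (2 *\<^sub>R sqrt_series T x)"
    by (intro has_sum_imp_sums has_sum_bounded_linear[OF bounded_linear_scaleR_right]
        has_sum_sqrt_series)
  ultimately have "2 *\<^sub>R sqrt_series T x =
      sqrt_series T (sqrt_series T x) + 2 *\<^sub>R (sqrt_coeff 0 *\<^sub>R (T ^^ Suc 0) x)"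
    by (metis sums_unique2)
  then show ?thesis by simp
qed

lemma rip_sqrt_series:
  assumes adj: "\<And>x y. rip (T x) y = rip x (T y)"
  shows "rip (sqrt_series T x) y = rip x (sqrt_series T y)"
proof -
  have P: "rip ((T ^^ n) x) y = rip x ((T ^^ n) y)" for n x y
    by (induction n arbitrary: x y) (simp_all add: adj funpow_swap1)
  have "((\<lambda>n. rip (sqrt_coeff n *\<^sub>R (T ^^ Suc n) x) y) has_sum rip (sqrt_series T x) y) UNIV"
    by (intro has_sum_bounded_linear[OF rip.bounded_linear_left] has_sum_sqrt_series)
  moreover have
    "((\<lambda>n. rip x (sqrt_coeff n *\<^sub>R (T ^^ Suc n) y)) has_sum rip x (sqrt_series T y)) UNIV"
    by (intro has_sum_bounded_linear[OF rip.bounded_linear_right] has_sum_sqrt_series)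
  ultimately show ?thesis
    unfolding rip.scaleR_left rip.scaleR_right P by (rule has_sum_unique)
qed

end

text \<open>Positivity is tested at \<open>x - P x / K\<close>: the last term of the expansion
  cancels at most half of the middle one. The bound serves both for contractivity in the series and
  for the kernel of \<open>P\<close>.\<close>

lemma norm_positive_op_le:
  assumes P: "positive_op smul ip P" and K: "K > 0" "\<And>x. norm (P x) \<le> K * norm x"
  shows "(norm (P x))\<^sup>2 \<le> K * rip (P x) x"
proof -
  have b: "bounded_op smul P" and adj: "\<And>x y. rip (P x) y = rip x (P y)"
    and pos: "\<And>x. 0 \<le> rip (P x) x" using P by (auto simp: positive_op_iff)
  interpret P: bounded_linear P by (rule bounded_op_bounded_linear[OF b])
  define y where "y = x - (1 / K) *\<^sub>R P x"
  have "0 \<le> rip (P y) y" by (rule pos)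
  also have "rip (P y) y = rip (P x) x - 2 / K * (norm (P x))\<^sup>2 + rip (P (P x)) (P x) / K\<^sup>2"
    by (simp add: y_def P.diff P.scaleR rip.diff_left rip.diff_right rip.scaleR_left
        rip.scaleR_right rip_self adj[of "P x" x] power2_eq_square diff_divide_distrib)
  finally have "0 \<le> \<dots>" .
  moreover have "rip (P (P x)) (P x) \<le> K * (norm (P x))\<^sup>2"
    using abs_rip_le[of "P (P x)" "P x"] mult_right_mono[OF K(2)[of "P x"] norm_ge_zero[of "P x"]]
    by (simp add: power2_eq_square mult.assoc)
  then have "rip (P (P x)) (P x) / K\<^sup>2 \<le> (norm (P x))\<^sup>2 / K"
    using K(1) by (simp add: field_simps power2_eq_square)
  ultimately have "(norm (P x))\<^sup>2 / K \<le> rip (P x) x" by simp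
  then show ?thesis using K(1) by (simp add: field_simps)
qed

lemma positive_op_bound:
  assumes "positive_op smul ip P"
  obtains K where "K > 0" "\<And>x. norm (P x) \<le> K * norm x"
proof -
  have "bounded_linear P"
    using assms by (intro bounded_op_bounded_linear) (simp add: positive_op_def)
  then show thesis using bounded_linear.pos_bounded[of P] that by (metis mult.commute)
qed

lemma positive_op_eq_0:
  assumes P: "positive_op smul ip P" and "rip (P x) x = 0"
  shows "P x = 0"
proof -
  obtain K where "K > 0" "\<And>x. norm (P x) \<le> K * norm x"
    using positive_op_bound[OF P] by blast
  from norm_positive_op_le[OF P this, of x] show ?thesis using assms(2) by simp
qed

text \<open>The series is taken at \<open>T = I - P / K\<close> for a norm bound \<open>K\<close>.
  The clause on commuting maps is carried along because uniqueness in \<open>sqrt_op\<close> rests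
  on it.\<close>

lemma sqrt_op_ex:
  assumes P: "positive_op smul ip P"
  shows "\<exists>R. positive_op smul ip R \<and> R \<circ> R = P \<and>
    (\<forall>S. bounded_linear S \<and> (\<forall>x. S (P x) = P (S x)) \<longrightarrow> (\<forall>x. S (R x) = R (S x)))"
proof -
  obtain K where K: "K > 0" "\<And>x. norm (P x) \<le> K * norm x" using positive_op_bound[OF P] by blast
  have b: "bounded_op smul P" and adj: "\<And>x y. rip (P x) y = rip x (P y)"
    and pos: "\<And>x. 0 \<le> rip (P x) x" using P by (auto simp: positive_op_iff)
  have Ps: "P (smul c x) = smul c (P x)" for c x using b by (simp add: bounded_op_iff)
  interpret P: bounded_linear P by (rule bounded_op_bounded_linear[OF b])
  define T where "T = (\<lambda>x. x - (1 / K) *\<^sub>R P x)"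
  have T: "bounded_linear T"
    unfolding T_def
    by (intro bounded_linear_sub bounded_linear_ident bounded_linear_const_scaleR
        P.bounded_linear_axioms)
  have T_le: "norm (T x) \<le> norm x" for x
  proof -
    have "(norm (T x))\<^sup>2 = (norm x)\<^sup>2 - 2 / K * rip (P x) x + (norm (P x))\<^sup>2 / K\<^sup>2"
      by (simp add: T_def norm_diff_sq rip.scaleR_right adj power_divide)
    moreover have "(norm (P x))\<^sup>2 / K\<^sup>2 \<le> rip (P x) x / K"
      using norm_positive_op_le[OF P K, of x] K(1) by (simp add: field_simps power2_eq_square)
    moreover have "0 \<le> rip (P x) x / K" using pos[of x] K(1) by simp
    ultimately have "(norm (T x))\<^sup>2 \<le> (norm x)\<^sup>2" by simp
    then show ?thesis by (rule power2_le_imp_le) simp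
  qed
  have Tsym: "rip (T x) y = rip x (T y)" for x y
    by (simp add: T_def rip.diff_left rip.diff_right rip.scaleR_left rip.scaleR_right adj)
  note series = T T_le
  define R where "R = (\<lambda>x. sqrt K *\<^sub>R (x - sqrt_series T x))"
  have R: "bounded_linear R"
    unfolding R_def
    by (intro bounded_linear_sub bounded_linear_ident bounded_linear_const_scaleR
        bounded_linear_sqrt_series series)
  have comm: "S (R x) = R (S x)" if "bounded_linear S" "\<And>x. S (P x) = P (S x)" for S x
  proof -
    interpret S: bounded_linear S by fact
    have "S (T x) = T (S x)" for x by (simp add: T_def S.diff S.scaleR that(2))
    then show ?thesis
      by (simp add: R_def S.diff S.scaleR sqrt_series_commute[OF series that(1)])
  qed
  have "bounded_op smul R"
    by (rule bounded_opI[OF R]) (use comm[OF bounded_linear_smul] Ps in simp)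
  moreover have "rip (R x) y = rip x (R y)" for x y
    by (simp add: R_def rip.diff_left rip.diff_right rip.scaleR_left rip.scaleR_right
        rip_sqrt_series[OF series Tsym])
  moreover have "0 \<le> rip (R x) x" for x
  proof -
    have "rip (sqrt_series T x) x \<le> norm (sqrt_series T x) * norm x"
      using abs_rip_le[of "sqrt_series T x" x] by simp
    also have "\<dots> \<le> (norm x)\<^sup>2"
      using mult_right_mono[OF norm_sqrt_series_le[OF series] norm_ge_zero[of x]]
      by (simp add: power2_eq_square)
    finally show ?thesis
      using K(1) by (simp add: R_def rip.diff_left rip.scaleR_left rip_self)
  qed
  ultimately have "positive_op smul ip R" by (simp add: positive_op_iff)
  moreover have "R (R x) = P x" for x
  proof -
    interpret Y: bounded_linear "sqrt_series T" by (rule bounded_linear_sqrt_series[OF series])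
    have "R (R x) = K *\<^sub>R (x - sqrt_series T x - (sqrt_series T x - sqrt_series T (sqrt_series T x)))"
      using K(1) by (simp add: R_def Y.scaleR Y.diff scaleR_diff_right)
    \<comment> \<open>The identity for the iterated series cancels the two linear terms, leaving
      only \<open>T\<close>.\<close>
    also have "\<dots> = K *\<^sub>R (x - T x)"
      by (simp add: sqrt_series_sqrt_series[OF series] scaleR_2)
    also have "\<dots> = P x" using K(1) by (simp add: T_def)
    finally show ?thesis .
  qed
  ultimately show ?thesis using comm by (intro exI[of _ R]) (auto simp: fun_eq_iff)
qed

text \<open>A second positive root \<open>S\<close> commutes with \<open>P = S \<circ> S\<close>,
  hence with the root \<open>R\<close> from the series.\<close>

lemma sqrt_op:
  assumes P: "positive_op smul ip P"
  shows "positive_op smul ip (sqrt_op smul ip P)" "sqrt_op smul ip P (sqrt_op smul ip P x) = P x"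
proof -
  obtain R where R: "positive_op smul ip R" "R \<circ> R = P"
    and comm: "\<And>S x. bounded_linear S \<Longrightarrow> (\<And>x. S (P x) = P (S x)) \<Longrightarrow> S (R x) = R (S x)"
    using sqrt_op_ex[OF P] by blast
  have "S = R" if S: "positive_op smul ip S" "S \<circ> S = P" for S
  proof
    fix x
    have bl: "bounded_linear S" "bounded_linear R"
      using S R by (auto simp: positive_op_def intro: bounded_op_bounded_linear)
    interpret S: bounded_linear S by fact
    interpret R: bounded_linear R by fact
    have adj: "rip (S u) w = rip u (S w)" "rip (R u) w = rip u (R w)" for u w
      using S(1) R(1) by (auto simp: positive_op_iff)
    have SP: "S (S u) = P u" and RP: "R (R u) = P u" for u
      using S(2) R(2) by (auto simp: fun_eq_iff)
    have SR: "S (R u) = R (S u)" for u by (rule comm[OF bl(1)]) (simp add: SP[symmetric])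
    \<comment> \<open>As \<open>R\<close> and \<open>S\<close> commute, \<open>R + S\<close> sends
      \<open>y\<close> to \<open>R (R x) - S (S x) = 0\<close>. Two nonnegative forms with sum zero
      both vanish, so \<open>R y = S y = 0\<close>.\<close>
    define y where "y = R x - S x"
    have "R y + S y = 0" by (simp add: y_def R.diff S.diff SR SP RP)
    then have "rip (R y) y + rip (S y) y = 0"
      by (metis rip.add_left rip.zero_left)
    moreover have "0 \<le> rip (R y) y" "0 \<le> rip (S y) y"
      using S(1) R(1) by (auto simp: positive_op_iff)
    ultimately have "R y = 0" "S y = 0"
      using positive_op_eq_0[OF R(1)] positive_op_eq_0[OF S(1)] by auto
    \<comment> \<open>By symmetry \<open>rip y y\<close> is
      \<open>rip x (R y) - rip x (S y)\<close>.\<close>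
    then have "rip y y = 0"
      by (subst y_def) (simp add: rip.diff_left adj rip.zero_right)
    then show "S x = R x" by (simp add: rip_self y_def)
  qed
  with R have "\<exists>!R. positive_op smul ip R \<and> R \<circ> R = P" by blast
  from theI'[OF this] show "positive_op smul ip (sqrt_op smul ip P)"
    "sqrt_op smul ip P (sqrt_op smul ip P x) = P x"
    unfolding sqrt_op_def by (auto simp: fun_eq_iff)
qed

lemma norm_sqrt_op:
  assumes "positive_op smul ip P"
  shows "(norm (sqrt_op smul ip P x))\<^sup>2 = rip (P x) x"
  using sqrt_op[OF assms] by (metis positive_op_iff rip_self)

end

section \<open>Controlled fusion frames\<close>

context hilbert_space
begin

text \<open>Positivity makes each scalar summand the image of a real number, so the frame condition
  becomes one on real sums.\<close>

lemma controlled_fusion_frame_iff: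
  assumes C: "bounded_op smul C"
    and pos: "\<And>i. i \<in> I \<Longrightarrow> positive_op smul ip (ctrl_op ip C C' (V i))"
  shows "controlled_fusion_frame smul ip C C' I V v A B \<longleftrightarrow>
    (\<forall>i\<in>I. closed_subspace smul (V i) \<and> v i > 0) \<and> 0 < A \<and> A \<le> B \<and>
    (\<forall>f. (\<lambda>i. (v i)\<^sup>2 * rip (ctrl_op ip C C' (V i) f) f) summable_on I \<and>
      A * (norm f)\<^sup>2 \<le> (\<Sum>\<^sub>\<infinity>i\<in>I. (v i)\<^sup>2 * rip (ctrl_op ip C C' (V i) f) f) \<and>
      (\<Sum>\<^sub>\<infinity>i\<in>I. (v i)\<^sup>2 * rip (ctrl_op ip C C' (V i) f) f) \<le> B * (norm f)\<^sup>2)"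
    (is "_ \<longleftrightarrow> ?V \<and> _ \<and> _ \<and> (\<forall>f. ?r f summable_on I \<and> _ f \<and> _ f)")
proof (cases ?V)
  case True
  have "((\<lambda>i. of_real ((v i)\<^sup>2) * ip (orth_proj ip (V i) (C' f)) (orth_proj ip (V i) (C f)))
      has_sum of_real s) I \<longleftrightarrow> (?r f has_sum s) I" for f s
  proof -
    have "((\<lambda>i. of_real ((v i)\<^sup>2) * ip (orth_proj ip (V i) (C' f)) (orth_proj ip (V i) (C f)))
      has_sum of_real s) I \<longleftrightarrow> ((\<lambda>i. of_real (?r f i) :: 'k) has_sum of_real s) I"
    proof (rule has_sum_cong)
      fix i assume i: "i \<in> I"
      then have "ip (orth_proj ip (V i) (C' f)) (orth_proj ip (V i) (C f)) =
          of_real (rip (ctrl_op ip C C' (V i) f) f)"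
        using True by (simp add: ip_ctrl_op[OF C, symmetric] ip_positive_op[OF pos])
      then show "of_real ((v i)\<^sup>2) *
          ip (orth_proj ip (V i) (C' f)) (orth_proj ip (V i) (C f)) = of_real (?r f i)"
        by simp
    qed
    then show ?thesis by (simp only: has_sum_of_real_iff)
  qed
  then show ?thesis
    unfolding controlled_fusion_frame_def
    by (simp add: has_sum_iff)
qed (auto simp: controlled_fusion_frame_def)

lemma l2_norm_sqrt_op:
  assumes "\<And>i. i \<in> I \<Longrightarrow> positive_op smul ip (P i)"
  shows "l2_norm I (\<lambda>i. v i *\<^sub>R sqrt_op smul ip (P i) f) =
    sqrt (\<Sum>\<^sub>\<infinity>i\<in>I. (v i)\<^sup>2 * rip (P i f) f)"
  unfolding l2_norm_def
  by (intro arg_cong[of _ _ sqrt] infsum_cong)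
    (simp add: power_mult_distrib norm_sqrt_op assms)

end

text \<open>Subadditivity of the square root at \<open>b\<close> and \<open>a - b\<close>; it
  supplies \<open>w - z \<le> d\<close> of the proof idea.\<close>

lemma sqrt_diff_le_sqrt_diff:
  assumes "0 \<le> b" "b \<le> (a::real)"
  shows "sqrt a - sqrt b \<le> sqrt (a - b)"
  using sqrt_add_le_add_sqrt[of b "a - b"] assms by simp

lemma l2_norm_nonneg: "0 \<le> l2_norm I g"
  by (simp add: l2_norm_def infsum_nonneg)

text \<open>The lower bound is claimed only for a positive numerator, since squaring loses its sign:
  at zero the bound is not positive, and a negative numerator can have a square too large to be a
  lower bound. The upper bound holds in every case.\<close>

theorem theorem4p3:
  fixes smul :: "'k::real_or_complex \<Rightarrow> 'a::banach \<Rightarrow> 'a"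
    and ip :: "'a \<Rightarrow> 'a \<Rightarrow> 'k"
    and C C' :: "'a \<Rightarrow> 'a"
    and I :: "'i set"
    and W Z :: "'i \<Rightarrow> 'a set"
    and v \<beta> :: "'i \<Rightarrow> real"
    and A B lam1 lam2 :: real
  assumes "hilbert_space smul ip"
    and "separable_space (euclidean :: 'a topology)"
    and "countable I"
    and "C \<in> GL smul" and "C' \<in> GL smul"
    and "controlled_fusion_frame smul ip C C' I W v A B"
    and "0 \<le> lam1" and "lam1 < 1" and "0 \<le> lam2" and "lam2 < 1"
    and "\<forall>i\<in>I. \<beta> i > 0" and "(\<lambda>i. (\<beta> i)\<^sup>2) summable_on I"
    and "controlled_perturbation smul ip I lam1 lam2 \<beta> C C' v W Z"
  shows "(\<exists>A'. controlled_fusion_frame smul ip C C' I Z v A'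
             ((((1 + lam1) * sqrt B + l2_norm I \<beta>) / (1 - lam2))\<^sup>2)) \<and>
         (l2_norm I \<beta> < (1 - lam1) * sqrt A \<longrightarrow>
           controlled_fusion_frame smul ip C C' I Z v
             ((((1 - lam1) * sqrt A - l2_norm I \<beta>) / (1 + lam2))\<^sup>2)
             ((((1 + lam1) * sqrt B + l2_norm I \<beta>) / (1 - lam2))\<^sup>2))"
proof -
  interpret hilbert_space smul ip by fact
  let ?P = "\<lambda>i. ctrl_op ip C C' (W i)" and ?Q = "\<lambda>i. ctrl_op ip C C' (Z i)"
  define b where "b = l2_norm I \<beta>"
  define L where "L = (((1 - lam1) * sqrt A - b) / (1 + lam2))\<^sup>2"
  define U where "U = (((1 + lam1) * sqrt B + b) / (1 - lam2))\<^sup>2"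
  \<comment> \<open>These are the frame sums, so the norms called \<open>w\<close> and
    \<open>z\<close> in the proof idea are their square roots.\<close>
  define w z where "w = (\<lambda>f. \<Sum>\<^sub>\<infinity>i\<in>I. (v i)\<^sup>2 * rip (?P i f) f)"
    and "z = (\<lambda>f. \<Sum>\<^sub>\<infinity>i\<in>I. (v i)\<^sup>2 * rip (?Q i f) f)"
  have C: "bounded_op smul C" using assms by (simp add: GL_def)
  have P: "positive_op smul ip (?P i)" and Q: "positive_op smul ip (?Q i)"
    and PQ: "positive_op smul ip (\<lambda>f. ?P i f - ?Q i f)" if "i \<in> I" for i
    using assms(13) that by (simp_all add: controlled_perturbation_def)
  have A: "0 < A" "A \<le> B"
    and w: "\<And>f. (\<lambda>i. (v i)\<^sup>2 * rip (?P i f) f) summable_on I"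
      "\<And>f. A * (norm f)\<^sup>2 \<le> w f" "\<And>f. w f \<le> B * (norm f)\<^sup>2"
    using assms(6) controlled_fusion_frame_iff[OF C P, where v = v and A = A and B = B] by (simp_all add: w_def)
  obtain A2 B2 where "controlled_fusion_frame smul ip C C' I Z v A2 B2"
    using assms(13) by (auto simp: controlled_perturbation_def)
  then have V: "\<forall>i\<in>I. closed_subspace smul (Z i) \<and> v i > 0" and A2: "0 < A2"
    and z: "\<And>f. (\<lambda>i. (v i)\<^sup>2 * rip (?Q i f) f) summable_on I" "\<And>f. A2 * (norm f)\<^sup>2 \<le> z f"
    using controlled_fusion_frame_iff[OF C Q, where v = v and A = A2 and B = B2] by (simp_all add: z_def)
  have frame: "controlled_fusion_frame smul ip C C' I Z v A' B'"
    if "0 < A'" "A' \<le> B'" "\<And>f. A' * (norm f)\<^sup>2 \<le> z f" "\<And>f. z f \<le> B' * (norm f)\<^sup>2" for A' B'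
    using controlled_fusion_frame_iff[OF C Q, where v = v and A = A' and B = B'] V z(1) that by (simp add: z_def)
  have b0: "0 \<le> b" by (simp add: b_def l2_norm_nonneg)
  have z_nonneg: "0 \<le> z f" for f
    using z(2)[of f] A2 by (meson less_imp_le mult_nonneg_nonneg order_trans zero_le_power2)
  have diff: "(\<Sum>\<^sub>\<infinity>i\<in>I. (v i)\<^sup>2 * rip (?P i f - ?Q i f) f) = w f - z f" for f
    using infsum_add[OF w(1) summable_on_uminus[THEN iffD2, OF z(1)], of f f]
    by (simp add: w_def z_def rip.diff_left right_diff_distrib infsum_uminus)
  have zw: "z f \<le> w f" for f
  proof -
    have "0 \<le> rip (?P i f - ?Q i f) f" if "i \<in> I" for i
      using PQ[OF that] unfolding positive_op_iff by blast
    then have "0 \<le> (\<Sum>\<^sub>\<infinity>i\<in>I. (v i)\<^sup>2 * rip (?P i f - ?Q i f) f)"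
      by (intro infsum_nonneg mult_nonneg_nonneg zero_le_power2)
    then show ?thesis by (simp add: diff)
  qed
  have pert: "sqrt (w f - z f) \<le> lam1 * sqrt (w f) + lam2 * sqrt (z f) + b * norm f" for f
  proof -
    have "l2_norm I (\<lambda>i. v i *\<^sub>R sqrt_op smul ip (\<lambda>g. ?P i g - ?Q i g) f)
          \<le> lam1 * l2_norm I (\<lambda>i. v i *\<^sub>R sqrt_op smul ip (?P i) f)
            + lam2 * l2_norm I (\<lambda>i. v i *\<^sub>R sqrt_op smul ip (?Q i) f) + b * norm f"
      using assms(13) unfolding controlled_perturbation_def b_def by blast
    moreover note l2_norm_sqrt_op[where I = I and v = v and f = f and P = ?P]
      l2_norm_sqrt_op[where I = I and v = v and f = f and P = ?Q]
      l2_norm_sqrt_op[where I = I and v = v and f = f and P = "\<lambda>i g. ?P i g - ?Q i g"]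
    ultimately show ?thesis using P Q PQ by (simp add: diff) (simp add: w_def z_def)
  qed
  \<comment> \<open>Adding nonnegative terms and dividing by \<open>1 - lam2\<close>, which is at
    most 1, can only increase \<open>sqrt B\<close>.\<close>
  have BU: "sqrt B \<le> ((1 + lam1) * sqrt B + b) / (1 - lam2)"
  proof -
    have "(1 - lam2) * sqrt B \<le> 1 * sqrt B" using assms A by (intro mult_right_mono) auto
    also have "\<dots> \<le> (1 + lam1) * sqrt B + b" using assms A b0 by (simp add: distrib_right)
    finally show ?thesis using assms by (simp add: field_simps)
  qed
  have "(sqrt B)\<^sup>2 \<le> U" unfolding U_def using A BU by (intro power_mono) auto
  then have BU': "B \<le> U" using A by simp
  have zU: "z f \<le> U * (norm f)\<^sup>2" for f
    using zw[of f] w(3)[of f] mult_right_mono[OF BU', of "(norm f)\<^sup>2"] by simp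
  \<comment> \<open>In the zero space \<open>A2\<close> may exceed \<open>U\<close>; the minimum
    keeps the bounds in order.\<close>
  have "controlled_fusion_frame smul ip C C' I Z v (min A2 U) U"
  proof (rule frame)
    show "0 < min A2 U" using A A2 BU' by simp
    show "min A2 U * (norm f)\<^sup>2 \<le> z f" for f
      using z(2)[of f] mult_right_mono[of "min A2 U" A2 "(norm f)\<^sup>2"] by simp
  qed (simp_all add: zU)
  moreover have "controlled_fusion_frame smul ip C C' I Z v L U" if lt: "b < (1 - lam1) * sqrt A"
  proof -
    define l where "l = ((1 - lam1) * sqrt A - b) / (1 + lam2)"
    have l: "0 < l" "L = l\<^sup>2" using lt assms by (simp_all add: l_def L_def)
    have "l * norm f \<le> sqrt (z f)" for f
    proof -
      have "sqrt A * norm f \<le> sqrt (w f)"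
        using real_sqrt_le_mono[OF w(2)[of f]] by (simp add: real_sqrt_mult)
      then have "(1 - lam1) * (sqrt A * norm f) \<le> (1 - lam1) * sqrt (w f)"
        using assms by (intro mult_left_mono) auto
      also have "\<dots> \<le> (1 + lam2) * sqrt (z f) + b * norm f"
        using sqrt_diff_le_sqrt_diff[OF z_nonneg zw, of f] pert[of f]
        by (simp add: algebra_simps)
      finally show ?thesis using assms by (simp add: l_def field_simps)
    qed
    then have "(l * norm f)\<^sup>2 \<le> (sqrt (z f))\<^sup>2" for f
      using l by (intro power_mono) auto
    then have zL: "L * (norm f)\<^sup>2 \<le> z f" for f
      using z_nonneg by (simp add: l power_mult_distrib)
    \<comment> \<open>The order of the bounds comes from the constants,
      \<open>L \<le> A \<le> B \<le> U\<close>; comparing both with \<open>z f\<close> would require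
      a nonzero \<open>f\<close>.\<close>
    have "l \<le> sqrt A"
    proof -
      have "(1 - lam1) * sqrt A - b \<le> (1 + lam2) * sqrt A"
        using assms A b0 mult_nonneg_nonneg[of "lam1 + lam2" "sqrt A"] by (simp add: algebra_simps)
      then show ?thesis using assms by (simp add: l_def field_simps)
    qed
    then have "l\<^sup>2 \<le> (sqrt A)\<^sup>2" using l by (intro power_mono) auto
    then have "L \<le> U" using A BU' l by simp
    then show ?thesis using l zL zU by (intro frame) auto
  qed
  ultimately show ?thesis unfolding L_def U_def b_def by blast
qed

end
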